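(* Let $F$ be either $F_1$ (the penalty case) or $F_2$ (the constraint case), and let $E_0(u)=\min_{\Lambda\in\{0,1\}^{M\times N}}F(u,\Lambda)$. Consider the following alternating minimization algorithm: starting from any $\Lambda^0\in\{0,1\}^{M\times N}$, for $k=1,2,\dots$, (i) $u^k$ is a minimizer over $u\in\mathbb{R}^{M\times N}$ of $\frac12\sum_{i,j}\Lambda^{k-1}_{i,j}((Hu)_{i,j}-f_{i,j})^2+\lambda_1J(u)$; (ii) among all minimizers $\Lambda$ of $F(u^k,\cdot)$ over $\{0,1\}^{M\times N}$, $\Lambda^k$ is chosen to be one for which $\min_{u}F(u,\Lambda)$ is lowest. The algorithm stops at the first $k\ge1$ for which $F(u^{k+1},\Lambda^{k+1})=F(u^k,\Lambda^k)$ (i.e. when the objective stops decreasing), and outputs $(u^*,\Lambda^* )=(u^k,\Lambda^k)$. Then the algorithm stops at a local minimum point of $E_0$: it terminates, and its output $u^*$ is a local minimizer of $E_0$ on $\mathbb{R}^{M\times N}$.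
   Context: Setting. $M,N$ are positive integers; images are elements of $\mathbb{R}^{M\times N}$; sums over $i,j$ run over $1\le i\le M$, $1\le j\le N$. $f\in\mathbb{R}^{M\times N}$ is a given observed image, $H:\mathbb{R}^{M\times N}\to\mathbb{R}^{M\times N}$ is a continuous operator (the identity or a blurring operator), $J:\mathbb{R}^{M\times N}\to\mathbb{R}$ is a regularization functional, $\lambda_1,\lambda_2>0$ are parameters, and $L$ is an integer with $0\le L\le MN$. Define, for $u\in\mathbb{R}^{M\times N}$ and $\Lambda\in\{0,1\}^{M\times N}$, $$F_1(u,\Lambda)=\tfrac12\sum_{i,j}\Lambda_{i,j}((Hu)_{i,j}-f_{i,j})^2+\lambda_1J(u)+\lambda_2\sum_{i,j}(1-\Lambda_{i,j}),$$ $$F_2(u,\Lambda)=\tfrac12\sum_{i,j}\Lambda_{i,j}((Hu)_{i,j}-f_{i,j})^2+\lambda_1J(u)+\iota(\Lambda),$$ where $\iota(\Lambda)=0$ if $\sum_{i,j}(1-\Lambda_{i,j})\le L$ and $\iota(\Lambda)=+\infty$ otherwise. Standing assumption: for every $\Lambda\in\{0,1\}^{M\times N}$, the function $u\mapsto\frac12\sum_{i,j}\Lambda_{i,j}((Hu)_{i,j}-f_{i,j})^2+\lambda_1J(u)$ attains its minimum on $\mathbb{R}^{M\times N}$ (so that the $u$-subproblems can be solved exactly). *)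

theory Defs
  imports "HOL-Analysis.Analysis"
begin

text \<open>An image in \<open>\<real>\<^sup>M\<^sup>\<times>\<^sup>N\<close> is a value of type \<open>real ^ 'n ^ 'm\<close>, where
  \<open>M = CARD('m)\<close> and \<open>N = CARD('n)\<close>; pixel \<open>(i, j)\<close> of \<open>u\<close> is \<open>u $ i $ j\<close>.
  The masks are the elements of \<open>{0,1}\<^sup>M\<^sup>\<times>\<^sup>N\<close>, viewed as real-valued images.\<close>

definition masks :: "(real ^ 'n ^ 'm) set" where
  "masks = {\<Lambda>. \<forall>i j. \<Lambda> $ i $ j \<in> {0, 1}}"

definition sub_energy ::
  "(real ^ 'n ^ 'm \<Rightarrow> real ^ 'n ^ 'm) \<Rightarrow> real ^ 'n ^ 'm \<Rightarrow> (real ^ 'n ^ 'm \<Rightarrow> real) \<Rightarrow> real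
    \<Rightarrow> real ^ 'n ^ 'm \<Rightarrow> real ^ 'n ^ 'm \<Rightarrow> real" where
  "sub_energy H f J lam1 \<Lambda> u =
    1 / 2 * (\<Sum>i\<in>UNIV. \<Sum>j\<in>UNIV. \<Lambda> $ i $ j * (H u $ i $ j - f $ i $ j)\<^sup>2) + lam1 * J u"

definition outliers :: "real ^ 'n ^ 'm \<Rightarrow> real" where
  "outliers \<Lambda> = (\<Sum>i\<in>UNIV. \<Sum>j\<in>UNIV. 1 - \<Lambda> $ i $ j)"

definition F1 ::
  "(real ^ 'n ^ 'm \<Rightarrow> real ^ 'n ^ 'm) \<Rightarrow> real ^ 'n ^ 'm \<Rightarrow> (real ^ 'n ^ 'm \<Rightarrow> real) \<Rightarrow> real \<Rightarrow> real
    \<Rightarrow> real ^ 'n ^ 'm \<Rightarrow> real ^ 'n ^ 'm \<Rightarrow> ereal" where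
  "F1 H f J lam1 lam2 u \<Lambda> = ereal (sub_energy H f J lam1 \<Lambda> u + lam2 * outliers \<Lambda>)"

definition \<iota> :: "nat \<Rightarrow> real ^ 'n ^ 'm \<Rightarrow> ereal" where
  "\<iota> L \<Lambda> = (if outliers \<Lambda> \<le> real L then 0 else \<infinity>)"

definition F2 ::
  "(real ^ 'n ^ 'm \<Rightarrow> real ^ 'n ^ 'm) \<Rightarrow> real ^ 'n ^ 'm \<Rightarrow> (real ^ 'n ^ 'm \<Rightarrow> real) \<Rightarrow> real \<Rightarrow> nat
    \<Rightarrow> real ^ 'n ^ 'm \<Rightarrow> real ^ 'n ^ 'm \<Rightarrow> ereal" where
  "F2 H f J lam1 L u \<Lambda> = ereal (sub_energy H f J lam1 \<Lambda> u) + \<iota> L \<Lambda>"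

definition E0 :: "(real ^ 'n ^ 'm \<Rightarrow> real ^ 'n ^ 'm \<Rightarrow> ereal) \<Rightarrow> real ^ 'n ^ 'm \<Rightarrow> ereal" where
  "E0 F u = Min (F u ` masks)"

definition local_minimizer :: "('a::metric_space \<Rightarrow> 'b::order) \<Rightarrow> 'a \<Rightarrow> bool" where
  "local_minimizer E u \<longleftrightarrow> (\<exists>\<epsilon>>0. \<forall>v\<in>ball u \<epsilon>. E u \<le> E v)"

text \<open>One iteration, producing \<open>u'\<close> and \<open>\<Lambda>'\<close> from the previous mask \<open>\<Lambda>\<close>. The infimum
  is a minimum whenever every \<^term>\<open>sub_energy H f J lam1 \<Lambda>\<close> attains its minimum: then
  \<open>\<lambda>u. F u \<Lambda>\<close> also does, being this function plus a real constant or constantly \<open>\<infinity>\<close>.\<close>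

definition alt_min_step ::
  "(real ^ 'n ^ 'm \<Rightarrow> real ^ 'n ^ 'm) \<Rightarrow> real ^ 'n ^ 'm \<Rightarrow> (real ^ 'n ^ 'm \<Rightarrow> real) \<Rightarrow> real
    \<Rightarrow> (real ^ 'n ^ 'm \<Rightarrow> real ^ 'n ^ 'm \<Rightarrow> ereal)
    \<Rightarrow> real ^ 'n ^ 'm \<Rightarrow> real ^ 'n ^ 'm \<Rightarrow> real ^ 'n ^ 'm \<Rightarrow> bool" where
  "alt_min_step H f J lam1 F \<Lambda> u' \<Lambda>' \<longleftrightarrow>
    is_arg_min (sub_energy H f J lam1 \<Lambda>) (\<lambda>_. True) u' \<and>
    is_arg_min (\<lambda>\<Lambda>''. INF v. F v \<Lambda>'') (is_arg_min (F u') (\<lambda>\<Lambda>''. \<Lambda>'' \<in> masks)) \<Lambda>'"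

definition stops_at ::
  "(real ^ 'n ^ 'm \<Rightarrow> real ^ 'n ^ 'm \<Rightarrow> ereal)
    \<Rightarrow> (nat \<Rightarrow> real ^ 'n ^ 'm) \<Rightarrow> (nat \<Rightarrow> real ^ 'n ^ 'm) \<Rightarrow> nat \<Rightarrow> bool" where
  "stops_at F u \<Lambda> k \<longleftrightarrow> 1 \<le> k \<and> F (u (k + 1)) (\<Lambda> (k + 1)) = F (u k) (\<Lambda> k)"

text \<open>A run of the algorithm. If the stopping test first succeeds at \<open>j\<close>, iterations
  \<open>1, \<dots>, j + 1\<close> have been carried out (the test at \<open>j\<close> looks at iterate \<open>j + 1\<close>), and the
  later entries of \<open>u\<close> and \<open>\<Lambda>\<close> are arbitrary. If it never succeeds, all iterations are
  carried out. The entry \<open>u 0\<close> plays no role.\<close>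

definition alt_min_run ::
  "(real ^ 'n ^ 'm \<Rightarrow> real ^ 'n ^ 'm) \<Rightarrow> real ^ 'n ^ 'm \<Rightarrow> (real ^ 'n ^ 'm \<Rightarrow> real) \<Rightarrow> real
    \<Rightarrow> (real ^ 'n ^ 'm \<Rightarrow> real ^ 'n ^ 'm \<Rightarrow> ereal)
    \<Rightarrow> (nat \<Rightarrow> real ^ 'n ^ 'm) \<Rightarrow> (nat \<Rightarrow> real ^ 'n ^ 'm) \<Rightarrow> bool" where
  "alt_min_run H f J lam1 F u \<Lambda> \<longleftrightarrow>
    \<Lambda> 0 \<in> masks \<and>
    (\<forall>k\<ge>1. (\<forall>j. stops_at F u \<Lambda> j \<longrightarrow> k \<le> j + 1) \<longrightarrow>
      alt_min_step H f J lam1 F (\<Lambda> (k - 1)) (u k) (\<Lambda> k))"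

lemma finite_masks: "finite (masks :: (real ^ 'n ^ 'm) set)"
proof -
  let ?g = "\<lambda>\<Lambda> :: real ^ 'n ^ 'm. {(i, j). \<Lambda> $ i $ j = 1}"
  have "inj_on ?g masks"
  proof (rule inj_onI)
    fix A B :: "real ^ 'n ^ 'm"
    assume A: "A \<in> masks" and B: "B \<in> masks" and eq: "?g A = ?g B"
    have "A $ i $ j = B $ i $ j" for i j
    proof -
      have "A $ i $ j = 0 \<or> A $ i $ j = 1" "B $ i $ j = 0 \<or> B $ i $ j = 1"
        using A B by (auto simp: masks_def)
      moreover have "(i, j) \<in> ?g A \<longleftrightarrow> (i, j) \<in> ?g B"
        using eq by (rule arg_cong)
      ultimately show ?thesis by auto
    qed
    then show "A = B" by (simp add: vec_eq_iff)
  qed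
  moreover have "finite (?g ` masks)" by (rule finite)
  ultimately show ?thesis by (rule finite_imageD[rotated])
qed

text \<open>Runs exist from every initial mask, so statements about all runs are not vacuous.\<close>

lemma alt_min_run_exists:
  fixes F :: "real ^ 'n ^ 'm \<Rightarrow> real ^ 'n ^ 'm \<Rightarrow> ereal"
  assumes att: "\<forall>\<Lambda>\<in>masks. \<exists>u. is_arg_min (sub_energy H f J lam1 \<Lambda>) (\<lambda>_. True) u"
    and "\<Lambda>0 \<in> masks"
  shows "\<exists>u \<Lambda>. alt_min_run H f J lam1 F u \<Lambda> \<and> \<Lambda> 0 = \<Lambda>0"
proof -
  have step: "\<exists>q. snd q \<in> masks \<and> alt_min_step H f J lam1 F \<Lambda> (fst q) (snd q)"
    if \<Lambda>: "\<Lambda> \<in> masks" for \<Lambda>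
  proof -
    from bspec[OF att \<Lambda>] obtain u'
      where u': "is_arg_min (sub_energy H f J lam1 \<Lambda>) (\<lambda>_. True) u'" ..
    define S where "S = {\<Lambda>'. is_arg_min (F u') (\<lambda>\<Lambda>'. \<Lambda>' \<in> masks) \<Lambda>'}"
    have sub: "S \<subseteq> masks"
      unfolding S_def is_arg_min_def by (rule subsetI) simp
    have ne: "masks \<noteq> ({} :: (real ^ 'n ^ 'm) set)"
      using \<Lambda> by (metis empty_iff)
    from ex_is_arg_min_if_finite[OF finite_masks ne] obtain \<Lambda>1
      where "is_arg_min (F u') (\<lambda>\<Lambda>'. \<Lambda>' \<in> masks) \<Lambda>1" ..
    then have "\<Lambda>1 \<in> S" unfolding S_def by (rule CollectI)
    then have "S \<noteq> {}" by (metis empty_iff)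
    from ex_is_arg_min_if_finite[OF finite_subset[OF sub finite_masks] this] obtain \<Lambda>'
      where min: "is_arg_min (\<lambda>\<Lambda>''. INF v. F v \<Lambda>'') (\<lambda>\<Lambda>''. \<Lambda>'' \<in> S) \<Lambda>'" ..
    from min have "\<Lambda>' \<in> S" unfolding is_arg_min_def by (rule conjunct1)
    with sub have "\<Lambda>' \<in> masks" by (rule subsetD)
    moreover have "alt_min_step H f J lam1 F \<Lambda> u' \<Lambda>'"
      unfolding alt_min_step_def using u' min[unfolded S_def mem_Collect_eq] by (rule conjI)
    ultimately show ?thesis by (intro exI[of _ "(u', \<Lambda>')"]) simp
  qed
  then obtain g where g: "\<And>\<Lambda>. \<Lambda> \<in> masks \<Longrightarrow>
      snd (g \<Lambda>) \<in> masks \<and> alt_min_step H f J lam1 F \<Lambda> (fst (g \<Lambda>)) (snd (g \<Lambda>))"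
    by metis
  define \<Lambda> where "\<Lambda> k = ((snd \<circ> g) ^^ k) \<Lambda>0" for k
  have \<Lambda>: "\<Lambda> k \<in> masks" for k
    by (induction k) (simp_all add: \<Lambda>_def assms(2) g)
  define u where "u k = fst (g (\<Lambda> (k - 1)))" for k
  have "alt_min_step H f J lam1 F (\<Lambda> (k - 1)) (u k) (\<Lambda> k)" if "k \<ge> 1" for k
  proof -
    have "\<Lambda> k = snd (g (\<Lambda> (k - 1)))"
      using that by (cases k) (simp_all add: \<Lambda>_def)
    then show ?thesis
      using g[OF \<Lambda>[of "k - 1"]] by (simp add: u_def)
  qed
  then have "alt_min_run H f J lam1 F u \<Lambda>"
    unfolding alt_min_run_def using \<Lambda> by blast
  moreover have "\<Lambda> 0 = \<Lambda>0" by (simp add: \<Lambda>_def)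
  ultimately show ?thesis by blast
qed

end

theory Submission
  imports Defs
begin

text \<open>
  Both objectives have the form \<open>F u \<Lambda> = ereal (sub_energy H f J lam1 \<Lambda> u) + c \<Lambda>\<close>, where
  \<open>c \<Lambda>\<close> is an extended real that does not involve \<open>u\<close>. Hence a minimizer of
  \<^term>\<open>sub_energy H f J lam1 \<Lambda>\<close> also minimizes \<open>\<lambda>u. F u \<Lambda>\<close>, and with
  \<open>m \<Lambda> = (INF v. F v \<Lambda>)\<close> and \<open>a k = F (u k) (\<Lambda> k)\<close> the iterates satisfy
  \<open>a (k + 1) \<le> m (\<Lambda> k) \<le> a k\<close> for \<open>k \<ge> 1\<close>.

  \<^emph>\<open>Termination.\<close> If the test never succeeds, \<open>a\<close> is strictly decreasing from index 1 on, and the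
  bracketing forces \<open>m (\<Lambda> k) > m (\<Lambda> (k + 2))\<close>; so every second mask is new, although there are
  only finitely many masks (\<open>bracketed_sequence_stalls\<close>).

  \<^emph>\<open>Local minimality.\<close> If the test first succeeds at \<open>k\<close>, the bracketing collapses to
  \<open>m (\<Lambda> k) = a k = E0 F (u k)\<close>. For two masks, the difference of the energies at \<open>v\<close> depends
  continuously on \<open>v\<close>: the regularizer, which may be discontinuous, cancels. As there are
  finitely many masks, each mask optimal at a point \<open>v\<close> close to \<open>u k\<close> is therefore already
  optimal at \<open>u k\<close> (\<open>argmins_upper_semicontinuous\<close>). If \<open>\<Lambda>'\<close> is such a mask, the selection rule
  of the algorithm gives \<open>E0 F v = F v \<Lambda>' \<ge> m \<Lambda>' \<ge> m (\<Lambda> k) = E0 F (u k)\<close>.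
\<close>

text \<open>A bracketing \<open>a (n + 1) \<le> m (x n) \<le> a n\<close> in which every \<open>x n\<close> lies in a finite set cannot
  go on strictly: strict decrease of \<open>a\<close> alone does not separate \<open>m (x n)\<close> from
  \<open>m (x (n + 1))\<close>, since both may equal \<open>a (n + 1)\<close>, but it does separate \<open>m (x n)\<close> from
  \<open>m (x (n + 2))\<close>.\<close>

lemma bracketed_sequence_stalls:
  fixes a :: "nat \<Rightarrow> 'b::linorder" and m :: "'x \<Rightarrow> 'b"
  assumes fin: "finite X" and x: "\<And>n. x n \<in> X"
    and lower: "\<And>n. a (Suc n) \<le> m (x n)" and upper: "\<And>n. m (x n) \<le> a n"
  shows "\<exists>n. a (Suc n) = a n"
proof (rule ccontr)
  assume "\<nexists>n. a (Suc n) = a n"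
  with order_trans[OF lower upper] have dec: "a (Suc n) < a n" for n
    by (simp add: order.strict_iff_order)
  define b where "b n = m (x (2 * n))" for n
  have "b (Suc n) < b n" for n
  proof -
    have "b (Suc n) \<le> a (Suc (Suc (2 * n)))"
      using upper[of "2 * Suc n"] by (simp add: b_def)
    also have "\<dots> < a (Suc (2 * n))" by (rule dec)
    also have "\<dots> \<le> b n" using lower[of "2 * n"] by (simp add: b_def)
    finally show ?thesis .
  qed
  then have "b j < b i" if "i < j" for i j
    using that by (induction j) (auto simp: less_Suc_eq intro: order.strict_trans)
  then have "inj b" by (metis injI linorder_neq_iff less_irrefl)
  moreover have "range b \<subseteq> m ` X" using x by (auto simp: b_def)
  ultimately show False
    using fin by (metis finite_imageI finite_subset finite_imageD infinite_UNIV_nat)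
qed

text \<open>The set of optimal indices of a finite family is upper semicontinuous. Continuity is
  required only of the differences \<open>e x - e y\<close>, so the family may have a discontinuous common
  summand. The offsets may be infinite; a comparison that they decide does not depend on \<open>v\<close>.\<close>

lemma argmins_upper_semicontinuous:
  fixes e :: "'x \<Rightarrow> 'a::t2_space \<Rightarrow> real" and c :: "'x \<Rightarrow> ereal"
  assumes fin: "finite X"
    and cont: "\<And>x y. x \<in> X \<Longrightarrow> y \<in> X \<Longrightarrow> isCont (\<lambda>v. e x v - e y v) u"
  shows "\<forall>\<^sub>F v in nhds u. \<forall>x. is_arg_min (\<lambda>x. ereal (e x v) + c x) (\<lambda>x. x \<in> X) x \<longrightarrow>
    is_arg_min (\<lambda>x. ereal (e x u) + c x) (\<lambda>x. x \<in> X) x"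
proof -
  define F where "F v x = ereal (e x v) + c x" for v x
  have stable: "\<forall>\<^sub>F v in nhds u. F u x < F u y \<longrightarrow> F v x < F v y" if "x \<in> X" "y \<in> X" for x y
  proof (cases "F u x < F u y")
    case less: True
    show ?thesis
    proof (cases "c x" "c y" rule: ereal2_cases)
      case (real_real r s)
      have "((\<lambda>v. e x v - e y v) \<longlongrightarrow> e x u - e y u) (nhds u)"
        using cont[OF that] by (simp add: isCont_def tendsto_nhds_iff)
      moreover have "e x u - e y u < s - r"
        using less real_real by (simp add: F_def)
      ultimately have "\<forall>\<^sub>F v in nhds u. e x v - e y v < s - r"
        by (rule order_tendstoD)
      then show ?thesis
        by (rule eventually_mono) (simp add: F_def real_real)
    qed (use less in \<open>simp_all add: F_def\<close>)
  qed simp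
  then have "\<forall>\<^sub>F v in nhds u. \<forall>x\<in>X. \<forall>y\<in>X. F u x < F u y \<longrightarrow> F v x < F v y"
    using fin by (intro eventually_ball_finite ballI)
  then have "\<forall>\<^sub>F v in nhds u. \<forall>x. is_arg_min (F v) (\<lambda>x. x \<in> X) x \<longrightarrow>
      is_arg_min (F u) (\<lambda>x. x \<in> X) x"
    by (rule eventually_mono) (metis is_arg_min_def)
  then show ?thesis by (simp add: F_def[abs_def])
qed

lemma isCont_sub_energy_diff:
  assumes "continuous_on UNIV H"
  shows "isCont (\<lambda>v. sub_energy H f J lam1 \<Lambda> v - sub_energy H f J lam1 \<Lambda>' v) u"
proof -
  have [continuous_intros]: "isCont H u"
    using assms by (simp add: continuous_on_eq_continuous_at)
  show ?thesis
    unfolding sub_energy_def by (simp, intro continuous_intros) simp_all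
qed

lemma E0_eq_at_argmin:
  assumes "is_arg_min (F u) (\<lambda>\<Lambda>. \<Lambda> \<in> masks) \<Lambda>"
  shows "E0 F u = F u \<Lambda>"
  unfolding E0_def
  using assms by (intro Min_eqI) (auto simp: finite_masks is_arg_min_linorder)

theorem corollary4p5:
  fixes H :: "real ^ 'n ^ 'm \<Rightarrow> real ^ 'n ^ 'm"
    and f :: "real ^ 'n ^ 'm"
    and J :: "real ^ 'n ^ 'm \<Rightarrow> real"
    and lam1 lam2 :: real
    and L :: nat
    and F :: "real ^ 'n ^ 'm \<Rightarrow> real ^ 'n ^ 'm \<Rightarrow> ereal"
    and u \<Lambda> :: "nat \<Rightarrow> real ^ 'n ^ 'm"
  assumes "continuous_on UNIV H"
    and "lam1 > 0" and "lam2 > 0"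
    and "L \<le> CARD('m) * CARD('n)"
    and "\<forall>\<Lambda>'\<in>masks. \<exists>v. is_arg_min (sub_energy H f J lam1 \<Lambda>') (\<lambda>_. True) v"
    and "F = F1 H f J lam1 lam2 \<or> F = F2 H f J lam1 L"
    and "alt_min_run H f J lam1 F u \<Lambda>"
  shows "(\<exists>k. stops_at F u \<Lambda> k) \<and>
    local_minimizer (E0 F) (u (LEAST k. stops_at F u \<Lambda> k))"
proof -
  define m where "m \<Lambda>' = (INF v. F v \<Lambda>')" for \<Lambda>'
  define a where "a k = F (u k) (\<Lambda> k)" for k
  obtain c where F: "\<And>v \<Lambda>'. F v \<Lambda>' = ereal (sub_energy H f J lam1 \<Lambda>' v) + c \<Lambda>'"
  proof (cases "F = F1 H f J lam1 lam2")
    case True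
    then show thesis
      by (intro that[of "\<lambda>\<Lambda>'. ereal (lam2 * outliers \<Lambda>')"]) (simp add: F1_def)
  next
    case False
    with assms(6) show thesis
      by (intro that[of "\<iota> L"]) (simp add: F2_def)
  qed
  have step: "alt_min_step H f J lam1 F (\<Lambda> (k - 1)) (u k) (\<Lambda> k)"
    if "1 \<le> k" "\<And>j. stops_at F u \<Lambda> j \<Longrightarrow> k \<le> j + 1" for k
    using assms(7) that unfolding alt_min_run_def by blast
  have mask_optimal: "is_arg_min (F (u k)) (\<lambda>\<Lambda>'. \<Lambda>' \<in> masks) (\<Lambda> k)"
    and mask_selected: "\<And>\<Lambda>'. is_arg_min (F (u k)) (\<lambda>\<Lambda>'. \<Lambda>' \<in> masks) \<Lambda>' \<Longrightarrow> m (\<Lambda> k) \<le> m \<Lambda>'"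
    if "1 \<le> k" "\<And>j. stops_at F u \<Lambda> j \<Longrightarrow> k \<le> j + 1" for k
    using step[OF that] unfolding alt_min_step_def is_arg_min_linorder m_def by blast+
  have bracketing: "a (Suc k) \<le> m (\<Lambda> k)" "m (\<Lambda> k) \<le> a k"
    if k: "1 \<le> k" "\<And>j. stops_at F u \<Lambda> j \<Longrightarrow> k \<le> j" for k
  proof -
    have k1: "1 \<le> Suc k" "\<And>j. stops_at F u \<Lambda> j \<Longrightarrow> Suc k \<le> j + 1"
      using k by auto
    have "\<Lambda> k \<in> masks"
      using mask_optimal[of k] k by (force simp: is_arg_min_def)
    then have "a (Suc k) \<le> F (u (Suc k)) (\<Lambda> k)"
      using mask_optimal[OF k1] by (simp add: a_def is_arg_min_linorder)
    also have "\<dots> \<le> m (\<Lambda> k)"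
      unfolding m_def
    proof (rule INF_greatest)
      fix v
      have "sub_energy H f J lam1 (\<Lambda> k) (u (Suc k)) \<le> sub_energy H f J lam1 (\<Lambda> k) v"
        using step[OF k1] by (simp add: alt_min_step_def is_arg_min_linorder)
      then show "F (u (Suc k)) (\<Lambda> k) \<le> F v (\<Lambda> k)"
        by (simp add: F add_right_mono)
    qed
    finally show "a (Suc k) \<le> m (\<Lambda> k)" .
    show "m (\<Lambda> k) \<le> a k"
      unfolding m_def a_def by (rule INF_lower) simp
  qed
  have stops: "\<exists>k. stops_at F u \<Lambda> k"
  proof (rule ccontr)
    assume never: "\<nexists>k. stops_at F u \<Lambda> k"
    \<comment> \<open>The sequences are shifted because \<open>u 0\<close> is arbitrary.\<close>
    have "\<exists>n. a (Suc (Suc n)) = a (Suc n)"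
    proof (rule bracketed_sequence_stalls[OF finite_masks])
      show "\<Lambda> (Suc n) \<in> masks" for n
        using mask_optimal[of "Suc n"] never by (simp add: is_arg_min_def)
      show "a (Suc (Suc n)) \<le> m (\<Lambda> (Suc n))" "m (\<Lambda> (Suc n)) \<le> a (Suc n)" for n
        using bracketing[of "Suc n"] never by simp_all
    qed
    then obtain n where "a (Suc (Suc n)) = a (Suc n)" ..
    then have "stops_at F u \<Lambda> (Suc n)" by (simp add: stops_at_def a_def)
    with never show False by blast
  qed
  define k where "k = (LEAST k. stops_at F u \<Lambda> k)"
  have "stops_at F u \<Lambda> k"
    unfolding k_def using stops by (rule LeastI_ex)
  then have k: "1 \<le> k" "a (Suc k) = a k"
    by (simp_all add: stops_at_def a_def)
  have least: "k \<le> j" if "stops_at F u \<Lambda> j" for j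
    unfolding k_def using that by (rule Least_le)
  have early: "k \<le> j + 1" if "stops_at F u \<Lambda> j" for j
    using least[OF that] by simp
  have "m (\<Lambda> k) = a k"
    using bracketing[OF k(1) least] k(2) by simp
  then have value_at_stop: "m (\<Lambda> k) = E0 F (u k)"
    using E0_eq_at_argmin[of F, OF mask_optimal[OF k(1) early]] by (simp add: a_def)
  have "\<forall>\<^sub>F v in nhds (u k). \<forall>\<Lambda>'. is_arg_min (F v) (\<lambda>\<Lambda>'. \<Lambda>' \<in> masks) \<Lambda>' \<longrightarrow>
      is_arg_min (F (u k)) (\<lambda>\<Lambda>'. \<Lambda>' \<in> masks) \<Lambda>'"
    using argmins_upper_semicontinuous[of masks "u k" "sub_energy H f J lam1" c]
      finite_masks isCont_sub_energy_diff[OF assms(1)]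
    by (simp add: F[THEN ext])
  then have "\<forall>\<^sub>F v in nhds (u k). E0 F (u k) \<le> E0 F v"
  proof (rule eventually_mono)
    fix v
    assume v: "\<forall>\<Lambda>'. is_arg_min (F v) (\<lambda>\<Lambda>'. \<Lambda>' \<in> masks) \<Lambda>' \<longrightarrow>
      is_arg_min (F (u k)) (\<lambda>\<Lambda>'. \<Lambda>' \<in> masks) \<Lambda>'"
    have "masks \<noteq> ({} :: (real ^ 'n ^ 'm) set)"
      using mask_optimal[OF k(1) early] by (auto simp: is_arg_min_def)
    then obtain \<Lambda>' where \<Lambda>': "is_arg_min (F v) (\<lambda>\<Lambda>'. \<Lambda>' \<in> masks) \<Lambda>'"
      using ex_is_arg_min_if_finite[OF finite_masks] by blast
    have "E0 F (u k) \<le> m \<Lambda>'"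
      using mask_selected[OF k(1) early] v \<Lambda>' value_at_stop by metis
    also have "\<dots> \<le> F v \<Lambda>'"
      unfolding m_def by (rule INF_lower) simp
    also have "\<dots> = E0 F v"
      using \<Lambda>' by (rule E0_eq_at_argmin[symmetric])
    finally show "E0 F (u k) \<le> E0 F v" .
  qed
  then have "local_minimizer (E0 F) (u k)"
    unfolding local_minimizer_def eventually_nhds_metric
    by (simp add: dist_commute Ball_def)
  with stops show ?thesis by (simp add: k_def)
qed

end
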